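(* Let $(\mathbb{F},+,\cdot)$ be an infinite division ring and let $\Gamma$ be a finite index subgroup of the multiplicative group $(\mathbb{F}\setminus\{0\},\cdot)$. For every nonzero $g\in\mathbb{F}$, the sets $g\Gamma$ and $\Gamma g$ are thick in $(\mathbb{F},+)$; in particular $\Gamma$ is thick in $(\mathbb{F},+)$.
   Context: A set $B\subseteq\mathbb{F}$ is thick in $(\mathbb{F},+)$ if for every finite $F\subseteq\mathbb{F}$ there exists $x\in\mathbb{F}$ with $F+x\subseteq B$. *)

theory Defs
  imports "HOL-Algebra.Multiplicative_Group"
begin

locale skew_field = ring R for R (structure) +
  assumes one_not_zero: "\<one> \<noteq> \<zero>"
    and nonzero_Units: "carrier R - {\<zero>} \<subseteq> Units R"

text \<open>Thickness is with respect to the additive structure of \<open>R\<close>: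
  \<open>F +> x\<close> is the translate of \<open>F\<close> by \<open>x\<close>.\<close>

definition thick :: "('a, 'b) ring_scheme \<Rightarrow> 'a set \<Rightarrow> bool" where
  "thick R B \<longleftrightarrow> B \<subseteq> carrier R \<and>
    (\<forall>F. finite F \<and> F \<subseteq> carrier R \<longrightarrow> (\<exists>x\<in>carrier R. F +>\<^bsub>R\<^esub> x \<subseteq> B))"

definition finite_index :: "('a, 'b) monoid_scheme \<Rightarrow> 'a set \<Rightarrow> bool" where
  "finite_index G H \<longleftrightarrow> finite (rcosets\<^bsub>G\<^esub> H)"

end

theory Submission
  imports Defs
begin

text \<open>
  Color focusing, as in the proof of van der Waerden's theorem, shows that for every finite
  coloring of an infinite ring and every finite set \<open>X\<close> some homothetic copy \<open>a + X d\<close> with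
  \<open>d \<noteq> 0\<close> is monochromatic. Color a skew field by the cosets \<open>\<Gamma> y\<close>, giving \<open>0\<close> a color of its
  own. Multiplying a monochromatic copy by the inverse of \<open>d\<close> shows that each finite set has a
  translate inside some right coset of \<open>\<Gamma>\<close>. There are finitely many cosets, so a single one is
  thick. Multiplication by a nonzero element on either side is an automorphism of the additive
  group, so it carries thickness over to \<open>\<Gamma>\<close> and to all \<open>g \<Gamma>\<close> and \<open>\<Gamma> g\<close>.
\<close>

text \<open>Comparing the patterns of a coloring on translates of a window calls for a bounded
  numbering of all patterns on \<open>W\<close>. One choice of \<open>e\<close> and \<open>M\<close>
  serves every coloring. Restricting to \<open>W\<close> first makes the patterns a finite
  set.\<close>

lemma finite_coloring_code:
  fixes W :: "'a set" and k :: nat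
  assumes "finite W"
  obtains e :: "('a \<Rightarrow> nat) \<Rightarrow> nat" and M :: nat
  where "\<forall>g \<in> W \<rightarrow> {..<k}. e g < M"
    and "\<forall>g \<in> W \<rightarrow> {..<k}. \<forall>g' \<in> W \<rightarrow> {..<k}. e g = e g' \<longrightarrow> (\<forall>w\<in>W. g w = g' w)"
proof -
  let ?P = "W \<rightarrow>\<^sub>E {..<k}"
  have "finite ?P" using assms by (intro finite_PiE) auto
  then obtain h where h: "bij_betw h ?P {0..<card ?P}"
    using ex_bij_betw_finite_nat by blast
  have P: "restrict g W \<in> ?P" if "g \<in> W \<rightarrow> {..<k}" for g using that by auto
  show thesis
  proof (rule that[of "\<lambda>g. h (restrict g W)" "card ?P"]; intro ballI impI)
    show "h (restrict g W) < card ?P" if "g \<in> W \<rightarrow> {..<k}" for g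
      using bij_betwE[OF h] P[OF that] by auto
  next
    fix g g' w
    assume g: "g \<in> W \<rightarrow> {..<k}" "g' \<in> W \<rightarrow> {..<k}"
      and eq: "h (restrict g W) = h (restrict g' W)" and w: "w \<in> W"
    have "restrict g W = restrict g' W"
      using inj_onD[OF bij_betw_imp_inj_on[OF h] eq P P] g by blast
    then show "g w = g' w" using w by (metis restrict_apply')
  qed
qed

section \<open>Gallai's theorem in infinite rings\<close>

context ring
begin

text \<open>
  The finite sets \<open>A\<close> and \<open>D\<close> must not depend on the coloring, because the induction colors a
  point by the pattern on a finite window around it. The set \<open>Z\<close> of forbidden dilations keeps
  sums of dilations away from zero.
\<close>

definition monochromatic_homothets :: "'a set \<Rightarrow> bool" where
  "monochromatic_homothets X \<longleftrightarrow>
    (\<forall>k Z. finite Z \<longrightarrow> (\<exists>A D. finite A \<and> A \<subseteq> carrier R \<and> finite D \<and> D \<subseteq> carrier R - Z \<and>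
      (\<forall>c :: 'a \<Rightarrow> nat. (\<forall>y\<in>carrier R. c y < k) \<longrightarrow>
        (\<exists>a\<in>A. \<exists>d\<in>D. \<exists>\<kappa>. \<forall>x\<in>X. c (a \<oplus> x \<otimes> d) = \<kappa>))))"

lemma monochromatic_homothetsE:
  assumes "monochromatic_homothets X" "finite Z"
  obtains A D where "finite A" "A \<subseteq> carrier R" "finite D" "D \<subseteq> carrier R - Z"
    "\<forall>c :: 'a \<Rightarrow> nat. (\<forall>y\<in>carrier R. c y < k) \<longrightarrow>
        (\<exists>a\<in>A. \<exists>d\<in>D. \<exists>\<kappa>. \<forall>x\<in>X. c (a \<oplus> x \<otimes> d) = \<kappa>)"
  using assms(1)[unfolded monochromatic_homothets_def, THEN spec[of _ k], THEN spec[of _ Z],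
      THEN mp, OF assms(2)]
  by (elim exE conjE) (rule that)

lemma monochromatic_homothets_singleton:
  assumes "infinite (carrier R)"
  shows "monochromatic_homothets {x}"
  unfolding monochromatic_homothets_def
proof (intro allI impI)
  fix k :: nat and Z :: "'a set"
  assume "finite Z"
  then obtain d where "d \<in> carrier R - Z"
    using assms by (metis Diff_infinite_finite finite.emptyI equals0I)
  then show "\<exists>A D. finite A \<and> A \<subseteq> carrier R \<and> finite D \<and> D \<subseteq> carrier R - Z \<and>
      (\<forall>c :: 'a \<Rightarrow> nat. (\<forall>y\<in>carrier R. c y < k) \<longrightarrow>
        (\<exists>a\<in>A. \<exists>d\<in>D. \<exists>\<kappa>. \<forall>x\<in>{x}. c (a \<oplus> x \<otimes> d) = \<kappa>))"
    by (intro exI[of _ "{\<zero>}"] exI[of _ "{d}"]) auto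
qed

text \<open>Adding \<open>u\<close> to the dilation of a spoke moves its point at \<open>x\<close>
  from the base \<open>b \<oplus> x\<^sub>0 \<otimes> u\<close> to
  \<open>b \<oplus> x \<otimes> u\<close>, because \<open>x\<^sub>0 \<otimes> u \<oplus> (x
  \<ominus> x\<^sub>0) \<otimes> u = x \<otimes> u\<close>.\<close>

lemma shift_focus:
  assumes "b \<in> carrier R" "u \<in> carrier R" "x\<^sub>0 \<in> carrier R" "x \<in> carrier R" "f \<in> carrier R"
    "d \<in> carrier R"
  shows "b \<oplus> x\<^sub>0 \<otimes> u \<oplus> f \<oplus> (x \<ominus> x\<^sub>0) \<otimes> (d \<oplus> u) = b \<oplus> x \<otimes> u \<oplus> (f \<oplus> (x \<ominus> x\<^sub>0) \<otimes> d)"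
proof -
  define s where "s = x \<ominus> x\<^sub>0"
  have s: "s \<in> carrier R" using assms by (simp add: s_def)
  have "x = x\<^sub>0 \<oplus> s"
    using assms by (simp add: s_def minus_eq a_comm[of x\<^sub>0 "x \<oplus> \<ominus> x\<^sub>0"] a_assoc l_neg)
  then have "x \<otimes> u = x\<^sub>0 \<otimes> u \<oplus> s \<otimes> u" using s assms by (simp add: l_distr)
  then show ?thesis
    unfolding s_def[symmetric] using s assms by (simp add: r_distr a_ac)
qed

text \<open>
  The second alternative provides \<open>r\<close> spokes of distinct colors around the focus \<open>f\<close>. They are
  homothetic copies of \<open>X\<close> which \<open>x\<^sub>0\<close> would extend by \<open>f\<close>.
\<close>

lemma color_focusing:
  fixes k r :: nat
  assumes X: "monochromatic_homothets X" "finite X" "X \<noteq> {}" "X \<subseteq> carrier R"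
    and x0: "x\<^sub>0 \<in> carrier R" and Z: "finite Z"
  shows "\<exists>A D. finite A \<and> A \<subseteq> carrier R \<and> finite D \<and> D \<subseteq> carrier R - Z \<and>
    (\<forall>c :: 'a \<Rightarrow> nat. (\<forall>y\<in>carrier R. c y < k) \<longrightarrow>
      (\<exists>a\<in>A. \<exists>d\<in>D. \<exists>\<kappa>. \<forall>x\<in>insert x\<^sub>0 X. c (a \<oplus> x \<otimes> d) = \<kappa>) \<or>
      (\<exists>f\<in>A. \<exists>C\<subseteq>{..<k}. card C = r \<and>
        (\<forall>\<kappa>\<in>C. \<exists>d\<in>D. \<forall>x\<in>X. c (f \<oplus> (x \<ominus> x\<^sub>0) \<otimes> d) = \<kappa>)))"
proof (induction r)
  case 0
  show ?case by (intro exI[of _ "{\<zero>}"] exI[of _ "{}"]) auto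
next
  case (Suc r)
  then obtain A D where A: "finite A" "A \<subseteq> carrier R"
    and D: "finite D" "D \<subseteq> carrier R - Z"
    and AD: "\<And>c :: 'a \<Rightarrow> nat. \<forall>y\<in>carrier R. c y < k \<Longrightarrow>
      (\<exists>a\<in>A. \<exists>d\<in>D. \<exists>\<kappa>. \<forall>x\<in>insert x\<^sub>0 X. c (a \<oplus> x \<otimes> d) = \<kappa>) \<or>
      (\<exists>f\<in>A. \<exists>C\<subseteq>{..<k}. card C = r \<and>
        (\<forall>\<kappa>\<in>C. \<exists>d\<in>D. \<forall>x\<in>X. c (f \<oplus> (x \<ominus> x\<^sub>0) \<otimes> d) = \<kappa>))"
    by blast
  obtain x1 where x1: "x1 \<in> X" using X by blast
  have Dc: "D \<subseteq> carrier R" using D by auto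
  \<comment> \<open>The window contains every possible focus from \<open>A\<close> and every point
    of a spoke around it, so equal patterns on \<open>W\<close> mean equally colored spokes and
    foci.\<close>
  define W where "W = A \<union> (\<Union>f\<in>A. \<Union>x\<in>X. (\<lambda>d. f \<oplus> (x \<ominus> x\<^sub>0) \<otimes> d) ` D)"
  note mem = subsetD[OF A(2)] subsetD[OF Dc] subsetD[OF X(4)]
  have W: "finite W" "W \<subseteq> carrier R" using A D X x0 by (auto simp: W_def mem)
  obtain e :: "('a \<Rightarrow> nat) \<Rightarrow> nat" and M :: nat
    where e_less: "\<forall>g \<in> W \<rightarrow> {..<k}. e g < M"
    and e_eq: "\<forall>g \<in> W \<rightarrow> {..<k}. \<forall>g' \<in> W \<rightarrow> {..<k}. e g = e g' \<longrightarrow> (\<forall>w\<in>W. g w = g' w)"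
    by (rule finite_coloring_code[OF W(1)])
  \<comment> \<open>New dilations occur alone and as \<open>d \<oplus> u\<close>; avoiding
    \<open>Z\<close> and all \<open>z \<ominus> d\<close> keeps both forms out of
    \<open>Z\<close>.\<close>
  define Z' where "Z' = Z \<union> (\<Union>z\<in>Z. (\<lambda>d. z \<ominus> d) ` D)"
  have "finite Z'" using Z D by (simp add: Z'_def)
  then obtain B E where B: "finite B" "B \<subseteq> carrier R"
    and E: "finite E" "E \<subseteq> carrier R - Z'"
    and BE: "\<forall>c :: 'a \<Rightarrow> nat. (\<forall>y\<in>carrier R. c y < M) \<longrightarrow>
        (\<exists>b\<in>B. \<exists>u\<in>E. \<exists>\<kappa>. \<forall>x\<in>X. c (b \<oplus> x \<otimes> u) = \<kappa>)"
    by (rule monochromatic_homothetsE[OF X(1)])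
  have Ec: "E \<subseteq> carrier R" using E by auto
  note mem = mem subsetD[OF Ec] subsetD[OF B(2)]
  have sum_notin: "d \<oplus> u \<notin> Z" if "d \<in> D" "u \<in> E" for d u
  proof
    assume "d \<oplus> u \<in> Z"
    moreover have "u = (d \<oplus> u) \<ominus> d"
      using that by (simp add: mem minus_eq a_comm[of d u] a_assoc r_neg)
    ultimately have "u \<in> Z'" using that unfolding Z'_def by force
    then show False using that E by auto
  qed
  \<comment> \<open>The three kinds of points are the base of a copy found at once, the new focus,
    and the base of a spoke completed by its focus.\<close>
  define A' where "A' = (\<Union>b\<in>B. \<Union>u\<in>E. \<Union>a\<in>A. {b \<oplus> x1 \<otimes> u \<oplus> a, b \<oplus> x\<^sub>0 \<otimes> u \<oplus> a} \<union>
    (\<lambda>d. b \<oplus> x1 \<otimes> u \<oplus> (a \<ominus> x\<^sub>0 \<otimes> d)) ` D)"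
  define D' where "D' = D \<union> E \<union> (\<Union>d\<in>D. (\<lambda>u. d \<oplus> u) ` E)"
  have A': "finite A'" "A' \<subseteq> carrier R" using A B D E x0 x1 by (auto simp: A'_def mem)
  have D': "finite D'" "D' \<subseteq> carrier R - Z"
    using D E sum_notin by (auto simp: D'_def Z'_def mem)
  have "(\<exists>a\<in>A'. \<exists>d\<in>D'. \<exists>\<kappa>. \<forall>x\<in>insert x\<^sub>0 X. c (a \<oplus> x \<otimes> d) = \<kappa>) \<or>
      (\<exists>f\<in>A'. \<exists>C\<subseteq>{..<k}. card C = Suc r \<and>
        (\<forall>\<kappa>\<in>C. \<exists>d\<in>D'. \<forall>x\<in>X. c (f \<oplus> (x \<ominus> x\<^sub>0) \<otimes> d) = \<kappa>))"
    if c: "\<forall>y\<in>carrier R. c y < k" for c :: "'a \<Rightarrow> nat"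
  proof -
    have code: "(\<lambda>w. c (y \<oplus> w)) \<in> W \<rightarrow> {..<k}" if "y \<in> carrier R" for y
      using W c that by auto
    then have "\<forall>y\<in>carrier R. e (\<lambda>w. c (y \<oplus> w)) < M" using e_less by blast
    \<comment> \<open>Each point is colored by the pattern of \<open>c\<close> on the window around
      it, and the hypothesis on \<open>X\<close> is applied to this coloring with \<open>M\<close>
      colors.\<close>
    from BE[THEN spec[of _ "\<lambda>y. e (\<lambda>w. c (y \<oplus> w))"], THEN mp, OF this]
    obtain b u \<kappa>' where b: "b \<in> B" and u: "u \<in> E"
      and \<kappa>': "\<And>x. x \<in> X \<Longrightarrow> e (\<lambda>w. c (b \<oplus> x \<otimes> u \<oplus> w)) = \<kappa>'" by blast
    have bu: "b \<in> carrier R" "u \<in> carrier R" using b u B Ec by auto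
    define y where "y = b \<oplus> x1 \<otimes> u"
    have y: "y \<in> carrier R" using bu x1 X by (auto simp: y_def)
    have window: "c (b \<oplus> x \<otimes> u \<oplus> w) = c (y \<oplus> w)" if "x \<in> X" "w \<in> W" for x w
    proof -
      have "b \<oplus> x \<otimes> u \<in> carrier R" using that bu by (simp add: mem)
      moreover have "e (\<lambda>w. c (b \<oplus> x \<otimes> u \<oplus> w)) = e (\<lambda>w. c (y \<oplus> w))"
        using \<kappa>' that x1 by (simp add: y_def)
      ultimately show ?thesis using e_eq code y that by blast
    qed
    \<comment> \<open>The induction hypothesis is used for \<open>c\<close> translated by
      \<open>y\<close>; \<open>window\<close> then copies what it gives to all the other points
      \<open>b \<oplus> x \<otimes> u\<close>.\<close>
    have "\<forall>w\<in>carrier R. c (y \<oplus> w) < k" using c y by auto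
    from AD[OF this] consider
      (mono) a d \<kappa> where "a \<in> A" "d \<in> D" "\<And>x. x \<in> insert x\<^sub>0 X \<Longrightarrow> c (y \<oplus> (a \<oplus> x \<otimes> d)) = \<kappa>"
    | (focus) f C where "f \<in> A" "C \<subseteq> {..<k}" "card C = r"
        "\<And>\<kappa>. \<kappa> \<in> C \<Longrightarrow> \<exists>d\<in>D. \<forall>x\<in>X. c (y \<oplus> (f \<oplus> (x \<ominus> x\<^sub>0) \<otimes> d)) = \<kappa>"
      by blast
    then show ?thesis
    proof cases
      case mono
      have "y \<oplus> a \<in> A'" using mono b u unfolding A'_def y_def by blast
      moreover have "d \<in> D'" using mono by (simp add: D'_def)
      moreover have "\<forall>x\<in>insert x\<^sub>0 X. c (y \<oplus> a \<oplus> x \<otimes> d) = \<kappa>"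
        using mono y A Dc X x0 by (metis a_assoc insert_iff m_closed subsetD)
      ultimately show ?thesis by blast
    next
      case focus
      have f: "f \<in> carrier R" "f \<in> W" using focus A by (auto simp: W_def)
      show ?thesis
      proof (cases "c (y \<oplus> f) \<in> C")
        \<comment> \<open>The focus has the color of one of its spokes. With base
          \<open>f \<ominus> x\<^sub>0 \<otimes> d\<close>, the point at \<open>x\<^sub>0\<close> is
          the focus itself, so spoke and focus form a monochromatic copy.\<close>
        case True
        then obtain d where d: "d \<in> D"
          and cd: "\<And>x. x \<in> X \<Longrightarrow> c (y \<oplus> (f \<oplus> (x \<ominus> x\<^sub>0) \<otimes> d)) = c (y \<oplus> f)"
          using focus(4) by blast
        have dc: "d \<in> carrier R" using d Dc by auto
        have "c (y \<oplus> (f \<ominus> x\<^sub>0 \<otimes> d) \<oplus> x \<otimes> d) = c (y \<oplus> f)" if "x \<in> insert x\<^sub>0 X" for x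
        proof -
          have xc: "x \<in> carrier R" using that X x0 by auto
          have eq: "y \<oplus> (f \<ominus> x\<^sub>0 \<otimes> d) \<oplus> x \<otimes> d = y \<oplus> (f \<oplus> (x \<ominus> x\<^sub>0) \<otimes> d)"
            using xc dc f y x0 by (simp add: minus_eq l_distr l_minus a_ac)
          show ?thesis
          proof (cases "x = x\<^sub>0")
            case True
            then show ?thesis unfolding eq using x0 f dc by (simp add: r_neg minus_eq)
          next
            case False
            then show ?thesis unfolding eq using cd that by blast
          qed
        qed
        moreover have "y \<oplus> (f \<ominus> x\<^sub>0 \<otimes> d) \<in> A'"
          using focus b u d unfolding A'_def y_def by blast
        moreover have "d \<in> D'" using d by (simp add: D'_def)
        ultimately show ?thesis by blast
      next
        case False
        \<comment> \<open>The focus has a new color. Around \<open>f'\<close> the old spokes survive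
          with dilation \<open>d \<oplus> u\<close>, and the translates of \<open>f\<close> form one
          more spoke, with dilation \<open>u\<close>.\<close>
        define f' where "f' = b \<oplus> x\<^sub>0 \<otimes> u \<oplus> f"
        have "f' \<in> A'" using focus b u unfolding A'_def f'_def by blast
        moreover have "insert (c (y \<oplus> f)) C \<subseteq> {..<k}" using focus c y f by auto
        moreover have "card (insert (c (y \<oplus> f)) C) = Suc r"
          using False focus finite_subset[OF focus(2)] by simp
        moreover have "\<exists>d\<in>D'. \<forall>x\<in>X. c (f' \<oplus> (x \<ominus> x\<^sub>0) \<otimes> d) = \<kappa>"
          if "\<kappa> \<in> insert (c (y \<oplus> f)) C" for \<kappa>
        proof (cases "\<kappa> \<in> C")
          case True
          then obtain d where d: "d \<in> D"
            and cd: "\<And>x. x \<in> X \<Longrightarrow> c (y \<oplus> (f \<oplus> (x \<ominus> x\<^sub>0) \<otimes> d)) = \<kappa>"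
            using focus(4) by blast
          have dc: "d \<in> carrier R" using d Dc by auto
          have "c (f' \<oplus> (x \<ominus> x\<^sub>0) \<otimes> (d \<oplus> u)) = \<kappa>" if x: "x \<in> X" for x
          proof -
            have xc: "x \<in> carrier R" using x X by auto
            have "f' \<oplus> (x \<ominus> x\<^sub>0) \<otimes> (d \<oplus> u) = b \<oplus> x \<otimes> u \<oplus> (f \<oplus> (x \<ominus> x\<^sub>0) \<otimes> d)"
              unfolding f'_def using xc dc f bu x0 by (intro shift_focus)
            moreover have "f \<oplus> (x \<ominus> x\<^sub>0) \<otimes> d \<in> W"
              using focus x d unfolding W_def by blast
            ultimately show ?thesis using window x cd by simp
          qed
          moreover have "d \<oplus> u \<in> D'" using d u unfolding D'_def by blast
          ultimately show ?thesis by blast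
        next
          case False
          \<comment> \<open>This is the additional spoke: the case \<open>d = \<zero>\<close> of
            \<open>shift_focus\<close>.\<close>
          have "c (f' \<oplus> (x \<ominus> x\<^sub>0) \<otimes> u) = \<kappa>" if x: "x \<in> X" for x
          proof -
            have xc: "x \<in> carrier R" using x X by auto
            have "f' \<oplus> (x \<ominus> x\<^sub>0) \<otimes> u = b \<oplus> x \<otimes> u \<oplus> f"
              unfolding f'_def using shift_focus[of b u x\<^sub>0 x f \<zero>] xc f bu x0 by simp
            then show ?thesis using window x f False that \<open>\<kappa> \<in> insert _ C\<close> by simp
          qed
          moreover have "u \<in> D'" using u by (simp add: D'_def)
          ultimately show ?thesis by blast
        qed
        ultimately show ?thesis by blast
      qed
    qed
  qed
  then show ?case using A' D' by blast
qed

text \<open>Focusing with \<open>r = Suc k\<close> would need more spoke colors than the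
  \<open>k\<close> available, so only the monochromatic copy remains.\<close>

lemma monochromatic_homothets_insert:
  assumes "monochromatic_homothets X" "finite X" "X \<noteq> {}" "X \<subseteq> carrier R" "x\<^sub>0 \<in> carrier R"
  shows "monochromatic_homothets (insert x\<^sub>0 X)"
  unfolding monochromatic_homothets_def
proof (intro allI impI)
  fix k :: nat and Z :: "'a set"
  assume Z: "finite Z"
  have no_focus: "\<not> (\<exists>C\<subseteq>{..<k}. card C = Suc k \<and> P C)" for P
  proof
    assume "\<exists>C\<subseteq>{..<k}. card C = Suc k \<and> P C"
    then obtain C where "C \<subseteq> {..<k}" "card C = Suc k" by blast
    then show False using card_mono[of "{..<k}" C] by simp
  qed
  show "\<exists>A D. finite A \<and> A \<subseteq> carrier R \<and> finite D \<and> D \<subseteq> carrier R - Z \<and>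
      (\<forall>c :: 'a \<Rightarrow> nat. (\<forall>y\<in>carrier R. c y < k) \<longrightarrow>
        (\<exists>a\<in>A. \<exists>d\<in>D. \<exists>\<kappa>. \<forall>x\<in>insert x\<^sub>0 X. c (a \<oplus> x \<otimes> d) = \<kappa>))"
    using color_focusing[OF assms Z, of k "Suc k"]
    by (simp only: no_focus bex_triv simp_thms)
qed

lemma monochromatic_homothets_finite:
  assumes "infinite (carrier R)" "finite X" "X \<noteq> {}" "X \<subseteq> carrier R"
  shows "monochromatic_homothets X"
  using assms(2-4)
  by (induction X rule: finite_ne_induct)
    (simp_all add: monochromatic_homothets_singleton[OF assms(1)] monochromatic_homothets_insert)

theorem gallai:
  assumes "infinite (carrier R)" "finite X" "X \<subseteq> carrier R" "finite (c ` carrier R)"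
  obtains a d \<kappa> where "a \<in> carrier R" "d \<in> carrier R" "d \<noteq> \<zero>"
    "\<And>x. x \<in> X \<Longrightarrow> c (a \<oplus> x \<otimes> d) = \<kappa>"
proof -
  obtain h where h: "bij_betw h (c ` carrier R) {0..<card (c ` carrier R)}"
    using ex_bij_betw_finite_nat[OF assms(4)] by blast
  \<comment> \<open>Adjoining \<open>\<zero>\<close> makes the pattern nonempty and puts
    \<open>a\<close> itself into the copy, so the common color is that of \<open>a\<close>.\<close>
  have "monochromatic_homothets (insert \<zero> X)"
    using assms by (intro monochromatic_homothets_finite) auto
  moreover have "finite {\<zero>}" by simp
  ultimately obtain A D where AD: "A \<subseteq> carrier R" "D \<subseteq> carrier R - {\<zero>}"
    and mono: "\<forall>c' :: 'a \<Rightarrow> nat. (\<forall>y\<in>carrier R. c' y < card (c ` carrier R)) \<longrightarrow>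
        (\<exists>a\<in>A. \<exists>d\<in>D. \<exists>\<kappa>. \<forall>x\<in>insert \<zero> X. c' (a \<oplus> x \<otimes> d) = \<kappa>)"
    by (rule monochromatic_homothetsE)
  have "\<forall>y\<in>carrier R. h (c y) < card (c ` carrier R)"
    using bij_betwE[OF h] by auto
  from mono[THEN spec[of _ "\<lambda>y. h (c y)"], THEN mp, OF this] obtain a d \<kappa> where "a \<in> A" "d \<in> D"
    and \<kappa>: "\<And>x. x \<in> insert \<zero> X \<Longrightarrow> h (c (a \<oplus> x \<otimes> d)) = \<kappa>" by blast
  then have ad: "a \<in> carrier R" "d \<in> carrier R" "d \<noteq> \<zero>" using AD by auto
  have "c (a \<oplus> x \<otimes> d) = c a" if "x \<in> X" for x
  proof (rule inj_onD[OF bij_betw_imp_inj_on[OF h]])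
    show "h (c (a \<oplus> x \<otimes> d)) = h (c a)" using \<kappa>[of x] \<kappa>[of \<zero>] that ad by simp
  qed (use that ad assms(3) in auto)
  then show thesis using that ad by blast
qed

end

section \<open>Thickness of multiplicative cosets in infinite skew fields\<close>

context skew_field
begin

lemma group_mult_of: "group (mult_of R)"
proof (rule groupI)
  fix x y assume "x \<in> carrier (mult_of R)" "y \<in> carrier (mult_of R)"
  then have xy: "x \<in> carrier R" "x \<in> Units R" "y \<in> carrier R" "y \<noteq> \<zero>"
    using nonzero_Units by auto
  have "x \<otimes> y \<noteq> \<zero>"
  proof
    assume "x \<otimes> y = \<zero>"
    then have "inv x \<otimes> x \<otimes> y = \<zero>" using xy by (simp add: m_assoc del: Units_l_inv)
    then show False using xy by simp
  qed
  then show "x \<otimes>\<^bsub>mult_of R\<^esub> y \<in> carrier (mult_of R)" using xy by simp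
next
  fix x assume "x \<in> carrier (mult_of R)"
  then have x: "x \<in> carrier R" "x \<in> Units R" using nonzero_Units by auto
  have "inv x \<noteq> \<zero>"
  proof
    assume "inv x = \<zero>"
    then show False using Units_l_inv[OF x(2)] x(1) one_not_zero by simp
  qed
  then show "\<exists>y\<in>carrier (mult_of R). y \<otimes>\<^bsub>mult_of R\<^esub> x = \<one>\<^bsub>mult_of R\<^esub>"
    using x by (intro bexI[of _ "inv x"]) auto
qed (use one_not_zero in \<open>auto simp: m_assoc\<close>)

text \<open>Pull \<open>F\<close> back along \<open>\<psi>\<close>, translate it into
  \<open>B\<close> by some \<open>x\<close>, and push forward: additivity turns the translation by
  \<open>x\<close> into one by \<open>\<phi> x\<close>.\<close>

lemma thick_automorphism_image:
  assumes B: "thick R B"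
    and closed: "\<And>x. x \<in> carrier R \<Longrightarrow> \<phi> x \<in> carrier R"
    and closed': "\<And>x. x \<in> carrier R \<Longrightarrow> \<psi> x \<in> carrier R"
    and inverse: "\<And>x. x \<in> carrier R \<Longrightarrow> \<phi> (\<psi> x) = x"
    and additive: "\<And>x y. x \<in> carrier R \<Longrightarrow> y \<in> carrier R \<Longrightarrow> \<phi> (x \<oplus> y) = \<phi> x \<oplus> \<phi> y"
  shows "thick R (\<phi> ` B)"
  unfolding thick_def
proof (intro conjI allI impI)
  have BR: "B \<subseteq> carrier R" using B by (simp add: thick_def)
  then show "\<phi> ` B \<subseteq> carrier R" using closed by auto
  fix F assume F: "finite F \<and> F \<subseteq> carrier R"
  then have "finite (\<psi> ` F)" "\<psi> ` F \<subseteq> carrier R" using closed' by auto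
  then obtain x where x: "x \<in> carrier R" "\<psi> ` F +> x \<subseteq> B" using B unfolding thick_def by blast
  have "y \<oplus> \<phi> x \<in> \<phi> ` B" if "y \<in> F" for y
  proof -
    have "\<psi> y \<oplus> x \<in> B" using x that by (auto simp: a_r_coset_def r_coset_def)
    moreover have "y \<oplus> \<phi> x = \<phi> (\<psi> y \<oplus> x)" using additive inverse closed' F x that by auto
    ultimately show ?thesis by blast
  qed
  then show "\<exists>x\<in>carrier R. F +> x \<subseteq> \<phi> ` B"
    using x closed by (intro bexI[of _ "\<phi> x"]) (auto simp: a_r_coset_def r_coset_def)
qed

lemma thick_l_coset:
  assumes "thick R B" "g \<in> carrier R - {\<zero>}"
  shows "thick R (g <#\<^bsub>mult_of R\<^esub> B)"
proof -
  have g: "g \<in> carrier R" "g \<in> Units R" using assms nonzero_Units by auto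
  have "thick R ((\<lambda>x. g \<otimes> x) ` B)"
    using g by (intro thick_automorphism_image[OF assms(1), of _ "\<lambda>x. inv g \<otimes> x"])
      (auto simp: r_distr m_assoc[symmetric])
  moreover have "g <#\<^bsub>mult_of R\<^esub> B = (\<lambda>x. g \<otimes> x) ` B" by (auto simp: l_coset_def)
  ultimately show ?thesis by simp
qed

lemma thick_r_coset:
  assumes "thick R B" "g \<in> carrier R - {\<zero>}"
  shows "thick R (B #>\<^bsub>mult_of R\<^esub> g)"
proof -
  have g: "g \<in> carrier R" "g \<in> Units R" using assms nonzero_Units by auto
  have "thick R ((\<lambda>x. x \<otimes> g) ` B)"
    using g by (intro thick_automorphism_image[OF assms(1), of _ "\<lambda>x. x \<otimes> inv g"])
      (auto simp: l_distr m_assoc)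
  moreover have "B #>\<^bsub>mult_of R\<^esub> g = (\<lambda>x. x \<otimes> g) ` B" by (auto simp: r_coset_def)
  ultimately show ?thesis by simp
qed

lemma finite_set_translate_in_coset:
  assumes "infinite (carrier R)" "subgroup \<Gamma> (mult_of R)" "finite_index (mult_of R) \<Gamma>"
    and F: "finite F" "F \<subseteq> carrier R"
  obtains C t where "C \<in> rcosets\<^bsub>mult_of R\<^esub> \<Gamma>" "t \<in> carrier R" "F +> t \<subseteq> C"
proof -
  interpret G: group "mult_of R" by (rule group_mult_of)
  have \<Gamma>: "\<Gamma> \<subseteq> carrier R - {\<zero>}" "\<one> \<in> \<Gamma>"
    using subgroup.subset[OF assms(2)] subgroup.one_closed[OF assms(2)] by auto
  \<comment> \<open>Since \<open>\<Gamma>\<close> multiplies on the left, a relation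
    \<open>a \<oplus> x \<otimes> d = h \<otimes> a\<close> survives division by \<open>d\<close> on
    the right.\<close>
  define c where "c y = (\<lambda>h. h \<otimes> y) ` \<Gamma>" for y
  have coset: "\<Gamma> #>\<^bsub>mult_of R\<^esub> y = c y" for y by (auto simp: r_coset_def c_def)
  have self: "y \<in> c y" if "y \<in> carrier R" for y
    using \<Gamma> that unfolding c_def by (metis image_eqI l_one)
  have c0: "c \<zero> = {\<zero>}" using \<Gamma> r_null unfolding c_def by (force simp: image_iff)
  have "c ` carrier R \<subseteq> insert {\<zero>} (rcosets\<^bsub>mult_of R\<^esub> \<Gamma>)"
    using c0 by (auto simp: RCOSETS_def coset)
  then have "finite (c ` carrier R)"
    using assms(3) unfolding finite_index_def by (meson finite_insert finite_subset)
  moreover have "finite (insert \<zero> (insert \<one> F))" "insert \<zero> (insert \<one> F) \<subseteq> carrier R"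
    using F by auto
  \<comment> \<open>Having both \<open>\<zero>\<close> and \<open>\<one>\<close> in the pattern rules out the color \<open>{\<zero>}\<close> of \<open>\<zero>\<close>.\<close>
  ultimately obtain a d \<kappa> where ad: "a \<in> carrier R" "d \<in> carrier R" "d \<noteq> \<zero>"
    and mono: "\<And>x. x \<in> insert \<zero> (insert \<one> F) \<Longrightarrow> c (a \<oplus> x \<otimes> d) = \<kappa>"
    using gallai[OF assms(1)] by metis
  have ca: "\<kappa> = c a" using mono[of \<zero>] ad by simp
  have d: "d \<in> Units R" using ad nonzero_Units by auto
  have a: "a \<noteq> \<zero>"
  proof
    assume "a = \<zero>"
    then show False using mono[of \<one>] ca c0 self[of d] ad by auto
  qed
  \<comment> \<open>Dividing \<open>a \<oplus> x \<otimes> d\<close> by \<open>d\<close> on the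
    right gives \<open>x \<oplus> t\<close>.\<close>
  define t where "t = a \<otimes> inv d"
  have "inv d \<in> carrier (mult_of R)"
    using d ad one_not_zero by (metis Diff_iff Units_inv_closed Units_r_inv carrier_mult_of
        r_null singletonD)
  then have t: "t \<in> carrier (mult_of R)"
    using G.m_closed[of a "inv d"] a ad by (simp add: t_def)
  have "x \<oplus> t \<in> \<Gamma> #>\<^bsub>mult_of R\<^esub> t" if x: "x \<in> F" for x
  proof -
    have xc: "x \<in> carrier R" using x F by auto
    have "a \<oplus> x \<otimes> d \<in> c a" using self[of "a \<oplus> x \<otimes> d"] mono[of x] x xc ad ca by auto
    then obtain h where h: "h \<in> \<Gamma>" "a \<oplus> x \<otimes> d = h \<otimes> a" unfolding c_def by auto
    have "x \<oplus> t = (a \<oplus> x \<otimes> d) \<otimes> inv d"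
      using xc ad d by (simp add: t_def l_distr m_assoc a_comm)
    also have "\<dots> = h \<otimes> t" using h \<Gamma> ad d by (auto simp: t_def m_assoc)
    finally show ?thesis using h by (auto simp: coset c_def)
  qed
  then have "F +> t \<subseteq> \<Gamma> #>\<^bsub>mult_of R\<^esub> t" by (auto simp: a_r_coset_def r_coset_def)
  then show thesis using that t by (auto simp: RCOSETS_def)
qed

text \<open>Otherwise each coset has a finite set with no translate inside it. The union of these
  sets is finite, so it has a translate inside some coset, against the choice made for that
  coset.\<close>

lemma ex_thick_r_coset:
  assumes "infinite (carrier R)" "subgroup \<Gamma> (mult_of R)" "finite_index (mult_of R) \<Gamma>"
  shows "\<exists>C \<in> rcosets\<^bsub>mult_of R\<^esub> \<Gamma>. thick R C"
proof (rule ccontr)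
  interpret G: group "mult_of R" by (rule group_mult_of)
  let ?C = "rcosets\<^bsub>mult_of R\<^esub> \<Gamma>"
  assume not_thick: "\<not> (\<exists>C \<in> ?C. thick R C)"
  have "\<forall>C\<in>?C. \<exists>F. finite F \<and> F \<subseteq> carrier R \<and> (\<forall>x\<in>carrier R. \<not> F +> x \<subseteq> C)"
  proof
    fix C assume C: "C \<in> ?C"
    then have "C \<subseteq> carrier R" using G.rcosets_subset_PowG[OF assms(2)] by auto
    moreover have "\<not> thick R C" using C not_thick by blast
    ultimately show "\<exists>F. finite F \<and> F \<subseteq> carrier R \<and> (\<forall>x\<in>carrier R. \<not> F +> x \<subseteq> C)"
      by (simp add: thick_def)
  qed
  from bchoice[OF this] obtain F where F: "\<And>C. C \<in> ?C \<Longrightarrow> finite (F C)"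
    "\<And>C. C \<in> ?C \<Longrightarrow> F C \<subseteq> carrier R"
    "\<And>C x. C \<in> ?C \<Longrightarrow> x \<in> carrier R \<Longrightarrow> \<not> F C +> x \<subseteq> C" by blast
  have "finite (\<Union>(F ` ?C))" "\<Union>(F ` ?C) \<subseteq> carrier R"
    using F assms(3) unfolding finite_index_def by auto
  then obtain C t where C: "C \<in> ?C" "t \<in> carrier R" "\<Union>(F ` ?C) +> t \<subseteq> C"
    by (rule finite_set_translate_in_coset[OF assms])
  then have "F C +> t \<subseteq> C" by (auto simp: a_r_coset_def r_coset_def)
  then show False using F(3) C by blast
qed

lemma finite_index_subgroup_thick:
  assumes "infinite (carrier R)" "subgroup \<Gamma> (mult_of R)" "finite_index (mult_of R) \<Gamma>"
  shows "thick R \<Gamma>"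
proof -
  interpret G: group "mult_of R" by (rule group_mult_of)
  obtain g where g: "g \<in> carrier (mult_of R)" "thick R (\<Gamma> #>\<^bsub>mult_of R\<^esub> g)"
    using ex_thick_r_coset[OF assms] by (auto simp: RCOSETS_def)
  have g': "inv\<^bsub>mult_of R\<^esub> g \<in> carrier R - {\<zero>}" using G.inv_closed[OF g(1)] by simp
  have "(\<Gamma> #>\<^bsub>mult_of R\<^esub> g) #>\<^bsub>mult_of R\<^esub> inv\<^bsub>mult_of R\<^esub> g = \<Gamma>"
    using G.coset_mult_assoc[OF subgroup.subset[OF assms(2)] g(1) G.inv_closed[OF g(1)]]
      G.r_inv[OF g(1)] G.coset_mult_one[OF subgroup.subset[OF assms(2)]] by simp
  then show ?thesis using thick_r_coset[OF g(2) g'] by simp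
qed

end

theorem theorem6p4:
  fixes R :: "('a, 'b) ring_scheme" (structure) and \<Gamma> :: "'a set"
  assumes "skew_field R"
    and "infinite (carrier R)"
    and "subgroup \<Gamma> (mult_of R)"
    and "finite_index (mult_of R) \<Gamma>"
  shows "(\<forall>g\<in>carrier R - {\<zero>}.
            thick R (g <#\<^bsub>mult_of R\<^esub> \<Gamma>) \<and> thick R (\<Gamma> #>\<^bsub>mult_of R\<^esub> g))
         \<and> thick R \<Gamma>"
proof -
  interpret skew_field R by (rule assms(1))
  show ?thesis
    using finite_index_subgroup_thick[OF assms(2-4)] thick_l_coset thick_r_coset by blast
qed

end
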